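(* Let $a$ and $b$ be positive integers with $\gcd(a,b)=1$, let $\lambda\in\mathbb{C}$ with $\lambda\neq 0$, $\lambda^a\neq 1$ and $\lambda^b\neq 1$, and let $m$ be a nonnegative integer. Then \begin{align*} S_m^{(\lambda)}(a,b)&=\lambda^{a b-1}\sum_{\ell=0}^m\sum_{i=0}^{\ell+2}\binom{\ell+2}{i}\binom{m}{\ell}\frac{a^{m-\ell+i-1}b^{m-i+1}}{(\ell+1)(\ell+2)}\mathcal B_i(\lambda^a)\mathcal B_{\ell-i+2}(\lambda^b)\\ &\quad -\frac{1}{(m+1)(m+2)\lambda}\sum_{i=0}^{m+2}\binom{m+2}{i}a^{i-1}b^{m-i+1}\mathcal B_i(\lambda^a)\mathcal B_{m-i+2}(\lambda^b)\\ &\quad -\frac{\mathcal B_{m+1}(\lambda)}{(m+1)\lambda}. \end{align*}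
   Context: For coprime positive integers $a,b$, $\mathrm{NR}(a,b)$ denotes the (finite) set of all nonnegative integers $n$ that cannot be expressed in the form $n=ax+by$ with $x,y$ nonnegative integers. (Since $0$ is representable, all elements are positive.) For a nonnegative integer $m$ and $\lambda\neq 0$, $$S_m^{(\lambda)}(a,b):=\sum_{n\in \mathrm{NR}(a,b)}\lambda^{n-1}n^m.$$ For a complex number $\mu\neq 1$, the Apostol-Bernoulli numbers $\mathcal B_n(\mu)$ ($n\ge 0$) are defined by the power series expansion at $z=0$ $$\frac{z}{\mu e^z-1}=\sum_{n=0}^\infty \mathcal B_n(\mu)\frac{z^n}{n!}.$$ For example, $\mathcal B_0(\mu)=0$, $\mathcal B_1(\mu)=\frac{1}{\mu-1}$, $\mathcal B_2(\mu)=-\frac{2\mu}{(\mu-1)^2}$. Powers of $a$ and $b$ with exponent $-1$ mean the rational numbers $1/a$, $1/b$. *)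

theory Defs
  imports "HOL-Analysis.Analysis" "HOL-Number_Theory.Cong"
begin

definition NR :: "nat \<Rightarrow> nat \<Rightarrow> nat set" where
  "NR a b = {n. \<not> (\<exists>x y :: nat. n = a * x + b * y)}"

text \<open>For coprime positive \<open>a\<close> and \<open>b\<close> the set \<open>NR a b\<close> is finite (see \<open>finite_NR\<close>
  below), so the following is a genuine finite sum.\<close>

definition power_sum_NR :: "complex \<Rightarrow> nat \<Rightarrow> nat \<Rightarrow> nat \<Rightarrow> complex" where
  "power_sum_NR lam m a b = (\<Sum>n\<in>NR a b. lam powi (int n - 1) * of_nat n ^ m)"

text \<open>The expansion at \<open>0\<close> is taken as a formal power series.  For \<open>\<mu> \<noteq> 1\<close> the denominator has
  the nonzero constant term \<open>\<mu> - 1\<close>, so the quotient is the genuine one; compare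
  \<open>apostol_bernoulli_has_fps_expansion\<close>.\<close>

definition apostol_bernoulli :: "nat \<Rightarrow> complex \<Rightarrow> complex" where
  "apostol_bernoulli n \<mu> =
     fact n * fps_nth (fps_X / (fps_const \<mu> * fps_exp 1 - 1)) n"

lemma finite_NR:
  assumes "a > 0" "b > 0" "coprime a b"
  shows "finite (NR a b)"
proof (rule finite_subset)
  show "NR a b \<subseteq> {..<a * b}"
  proof
    fix n assume n: "n \<in> NR a b"
    show "n \<in> {..<a * b}"
    proof (rule ccontr)
      assume "n \<notin> {..<a * b}"
      hence ge: "n \<ge> a * b" by simp
      obtain w where w: "[a * w = 1] (mod b)"
        using cong_solve_coprime_nat[OF assms(3)] by auto
      define x where "x = w * n mod b"
      have "[a * w * n = 1 * n] (mod b)"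
        using w by (rule cong_scalar_right)
      hence x: "[a * x = n] (mod b)"
        by (simp add: x_def cong_def mod_mult_right_eq mult.assoc)
      have "x < b" using assms(2) by (simp add: x_def)
      hence le: "a * x \<le> n"
        using ge mult_le_mono2[of x b a] by linarith
      have "b dvd n - a * x"
        using cong_altdef_nat[OF le] cong_sym[OF x] by simp
      then obtain y where "n - a * x = b * y" by (elim dvdE)
      hence "n = a * x + b * y" using le by simp
      with n show False by (auto simp: NR_def)
    qed
  qed
qed simp

lemma apostol_bernoulli_has_fps_expansion:
  assumes "\<mu> \<noteq> 1"
  shows "(\<lambda>z. z / (\<mu> * exp z - 1)) has_fps_expansion
           Abs_fps (\<lambda>n. apostol_bernoulli n \<mu> / fact n)"
proof -
  have "Abs_fps (\<lambda>n. apostol_bernoulli n \<mu> / fact n) =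
          fps_X / (fps_const \<mu> * fps_exp 1 - 1)"
    by (simp add: fps_eq_iff apostol_bernoulli_def)
  moreover have "(\<lambda>z. z / (\<mu> * exp z - 1)) has_fps_expansion
          fps_X / (fps_const \<mu> * fps_exp 1 - 1)"
  proof -
    have "(\<lambda>z::complex. \<mu> * exp (1 * z) - 1) has_fps_expansion (fps_const \<mu> * fps_exp 1 - 1)"
      by (intro fps_expansion_intros)
    thus ?thesis
      using assms by (intro has_fps_expansion_divide') (auto intro: fps_expansion_intros)
  qed
  ultimately show ?thesis by simp
qed

end

theory Submission
  imports Defs
begin

unbundle no vec_syntax
unbundle fps_syntax

text \<open>Put \<open>w = \<lambda> e\<^sup>X\<close> as a formal power series. In any commutative ring
  \<open>(\<Sum>n\<in>NR a b. w^n) (w - 1) (w^a - 1) (w^b - 1) = (w^(a b) - 1) (w - 1) - (w^a - 1) (w^b - 1)\<close>,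
  which is obtained by sorting the non-representable numbers by their residue class modulo \<open>b\<close>:
  the least representable number congruent to \<open>a x\<close> for \<open>x < b\<close> is \<open>a x\<close> itself, so each class
  contributes a geometric sum. Multiplying by \<open>X / (w - 1)\<close>, \<open>X / (w^a - 1)\<close> and \<open>X / (w^b - 1)\<close>,
  whose coefficients are Apostol-Bernoulli numbers, and comparing the coefficients of \<open>X^(m + 2)\<close>
  gives the formula.\<close>

section \<open>Non-representable numbers by residue class\<close>

lemma mult_mod_inj_on:
  fixes a b :: nat
  assumes "coprime a b"
  shows "inj_on (\<lambda>x. a * x mod b) {..<b}"
proof (rule inj_onI)
  fix x y assume "x \<in> {..<b}" "y \<in> {..<b}" "a * x mod b = a * y mod b"
  then have "[x = y] (mod b)"
    using cong_mult_lcancel_nat[OF assms] by (simp add: cong_def)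
  with \<open>x \<in> {..<b}\<close> \<open>y \<in> {..<b}\<close> show "x = y"
    by (simp add: cong_def)
qed

lemma mult_mod_bij_betw:
  fixes a b :: nat
  assumes "b > 0" "coprime a b"
  shows "bij_betw (\<lambda>x. a * x mod b) {..<b} {..<b}"
  unfolding bij_betw_def
proof
  show inj: "inj_on (\<lambda>x. a * x mod b) {..<b}"
    using assms(2) by (rule mult_mod_inj_on)
  show "(\<lambda>x. a * x mod b) ` {..<b} = {..<b}"
    using assms(1) inj by (intro endo_inj_surj) auto
qed

text \<open>The classes modulo \<open>b\<close> are indexed by \<open>x < b\<close> through the
  residue of \<open>a * x\<close>. If \<open>a * u + b * v\<close> lies in the class of
  \<open>x\<close>, then \<open>u\<close> is congruent to \<open>x\<close>, so
  \<open>u \<ge> x\<close>. Hence the gaps of this class are its members below \<open>a * x\<close>,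
  one for each quotient \<open>j < a * x div b\<close>.\<close>

lemma NR_residue_bij_betw:
  assumes "b > 0" "coprime a b"
  shows "bij_betw (\<lambda>(x, j). a * x mod b + b * j) (SIGMA x:{..<b}. {..<a * x div b}) (NR a b)"
  unfolding bij_betw_def
proof
  let ?f = "\<lambda>(x, j). a * x mod b + b * j"
  let ?D = "SIGMA x:{..<b}. {..<a * x div b}"
  show "inj_on ?f ?D"
  proof (rule inj_onI)
    fix p q assume "p \<in> ?D" "q \<in> ?D" and "?f p = ?f q"
    then obtain x j y k where p: "p = (x, j)" "x < b" and q: "q = (y, k)" "y < b"
      and eq: "a * x mod b + b * j = a * y mod b + b * k"
      by auto
    have "(a * x mod b + b * j) mod b = (a * y mod b + b * k) mod b"
      using eq by simp
    then have "a * x mod b = a * y mod b"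
      by simp
    then have "x = y"
      using mult_mod_inj_on[OF assms(2)] p(2) q(2) by (auto dest: inj_onD)
    then show "p = q"
      using eq assms(1) p(1) q(1) by simp
  qed
  show "?f ` ?D = NR a b"
  proof (rule equalityI; rule subsetI)
    fix n assume "n \<in> ?f ` ?D"
    then obtain x j where x: "x < b" and j: "j < a * x div b" and n: "n = a * x mod b + b * j"
      by auto
    have "b * j < b * (a * x div b)"
      using j assms(1) by simp
    then have less: "n < a * x"
      using n mult_div_mod_eq[of b "a * x"] by linarith
    show "n \<in> NR a b"
      unfolding NR_def
    proof clarify
      fix u v assume uv: "n = a * u + b * v"
      have "a * x mod b = n mod b"
        using n by simp
      also have "\<dots> = a * u mod b"
        using uv by simp
      finally have "[x = u] (mod b)"
        using cong_mult_lcancel_nat[OF assms(2)] by (simp add: cong_def)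
      \<comment> \<open>As \<open>x < b\<close>, it is the least natural number in its class modulo
        \<open>b\<close>.\<close>
      then have "x \<le> u"
        using x mod_less_eq_dividend[of u b] by (simp add: cong_def)
      then have "a * x \<le> n"
        using uv mult_le_mono2[of x u a] by linarith
      with less show False by simp
    qed
  next
    fix n assume n: "n \<in> NR a b"
    have "n mod b \<in> (\<lambda>x. a * x mod b) ` {..<b}"
      using mult_mod_bij_betw[OF assms] assms(1) by (simp add: bij_betw_def)
    then obtain x where x: "x < b" and cong: "n mod b = a * x mod b"
      by auto
    have less: "n < a * x"
    proof (rule ccontr)
      assume "\<not> n < a * x"
      then have "b dvd n - a * x"
        using cong by (simp add: mod_eq_dvd_iff_nat)
      then obtain y where "n - a * x = b * y" ..
      then have "n = a * x + b * y"
        using \<open>\<not> n < a * x\<close> by simp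
      with n show False by (auto simp: NR_def)
    qed
    \<comment> \<open>Equal remainders turn the comparison of \<open>n\<close> with
      \<open>a * x\<close> into one of quotients.\<close>
    have "b * (n div b) < b * (a * x div b)"
      using less cong mult_div_mod_eq[of b n] mult_div_mod_eq[of b "a * x"] by linarith
    then have "n div b < a * x div b"
      by simp
    moreover have "n = ?f (x, n div b)"
      using cong by (simp flip: cong)
    ultimately show "n \<in> ?f ` ?D"
      using x by (intro image_eqI[of _ _ "(x, n div b)"]) auto
  qed
qed

text \<open>The factor \<open>w ^ b - 1\<close> telescopes the geometric sum of each class to its
  two ends \<open>(w ^ a) ^ x\<close> and \<open>w ^ (a * x mod b)\<close>, and the latter exponents
  run through all residues. No division occurs, so \<open>w\<close> may later be a power
  series.\<close>

lemma sum_NR_power_mult: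
  fixes w :: "'a::comm_ring_1"
  assumes "b > 0" "coprime a b"
  shows "(w ^ b - 1) * (\<Sum>n\<in>NR a b. w ^ n) = (\<Sum>x<b. (w ^ a) ^ x) - (\<Sum>x<b. w ^ x)"
proof -
  have "(\<Sum>n\<in>NR a b. w ^ n) =
      (\<Sum>(x, j)\<in>(SIGMA x:{..<b}. {..<a * x div b}). w ^ (a * x mod b + b * j))"
    using sum.reindex_bij_betw[OF NR_residue_bij_betw[OF assms], of "\<lambda>n. w ^ n"]
    by (simp add: case_prod_unfold)
  also have "\<dots> = (\<Sum>x<b. \<Sum>j<a * x div b. w ^ (a * x mod b + b * j))"
    by (simp add: sum.Sigma)
  also have "(w ^ b - 1) * \<dots> =
      (\<Sum>x<b. w ^ (a * x mod b) * ((w ^ b - 1) * (\<Sum>j<a * x div b. (w ^ b) ^ j)))"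
    by (simp add: sum_distrib_left power_add mult_ac flip: power_mult)
  also have "\<dots> = (\<Sum>x<b. (w ^ a) ^ x - w ^ (a * x mod b))"
  proof (rule sum.cong[OF refl])
    fix x
    have "w ^ (a * x mod b) * (w ^ b) ^ (a * x div b) = (w ^ a) ^ x"
      by (simp flip: power_mult power_add)
    then show "w ^ (a * x mod b) * ((w ^ b - 1) * (\<Sum>j<a * x div b. (w ^ b) ^ j)) =
        (w ^ a) ^ x - w ^ (a * x mod b)"
      by (simp add: right_diff_distrib flip: power_diff_1_eq)
  qed
  also have "\<dots> = (\<Sum>x<b. (w ^ a) ^ x) - (\<Sum>x<b. w ^ (a * x mod b))"
    by (rule sum_subtractf)
  also have "(\<Sum>x<b. w ^ (a * x mod b)) = (\<Sum>x<b. w ^ x)"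
    by (rule sum.reindex_bij_betw[OF mult_mod_bij_betw[OF assms]])
  finally show ?thesis .
qed

text \<open>The factors \<open>w ^ a - 1\<close> and \<open>w - 1\<close> close the two geometric
  sums over \<open>x < b\<close>, to \<open>w ^ (a * b) - 1\<close> and
  \<open>w ^ b - 1\<close>.\<close>

lemma sum_NR_power:
  fixes w :: "'a::comm_ring_1"
  assumes "b > 0" "coprime a b"
  shows "(\<Sum>n\<in>NR a b. w ^ n) * (w - 1) * (w ^ a - 1) * (w ^ b - 1) =
    (w ^ (a * b) - 1) * (w - 1) - (w ^ a - 1) * (w ^ b - 1)"
proof -
  have "(\<Sum>n\<in>NR a b. w ^ n) * (w - 1) * (w ^ a - 1) * (w ^ b - 1) =
      (w - 1) * (w ^ a - 1) * ((w ^ b - 1) * (\<Sum>n\<in>NR a b. w ^ n))"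
    by (simp only: mult_ac)
  also have "\<dots> = ((w ^ a - 1) * (\<Sum>x<b. (w ^ a) ^ x)) * (w - 1)
      - (w ^ a - 1) * ((w - 1) * (\<Sum>x<b. w ^ x))"
    unfolding sum_NR_power_mult[OF assms] by (simp add: algebra_simps)
  also have "\<dots> = (w ^ (a * b) - 1) * (w - 1) - (w ^ a - 1) * (w ^ b - 1)"
    by (simp only: power_mult flip: power_diff_1_eq)
  finally show ?thesis .
qed

section \<open>Generating series of the Apostol-Bernoulli numbers\<close>

text \<open>For \<open>c > 0\<close> and \<open>\<mu> \<noteq> 1\<close> this is the expansion of
  \<open>X / (\<mu> e^(c X) - 1)\<close>. Rescaling the variable gives \<open>c^i\<close>, and the
  numerator \<open>X\<close> in place of \<open>c X\<close> takes away one power of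
  \<open>c\<close>.\<close>

definition ab_fps :: "nat \<Rightarrow> complex \<Rightarrow> complex fps" where
  "ab_fps c \<mu> = Abs_fps (\<lambda>i. of_nat c powi (int i - 1) * apostol_bernoulli i \<mu> / fact i)"

text \<open>Substitute \<open>c X\<close> for \<open>X\<close> in the quotient defining the
  Apostol-Bernoulli numbers, whose denominator is a unit, and cancel the constant
  \<open>c\<close>.\<close>

lemma ab_fps_mult:
  assumes "c > 0" "\<mu> \<noteq> 1"
  shows "ab_fps c \<mu> * (fps_const \<mu> * fps_exp (of_nat c) - 1) = fps_X"
proof -
  let ?D = "fps_const \<mu> * fps_exp 1 - 1" and ?c = "of_nat c :: complex"
  let ?B = "fps_X / ?D"
  have "?D $ 0 \<noteq> 0"
    using assms(2) by simp
  then have "?B * ?D = fps_X"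
    by (simp add: fps_divide_unit inverse_mult_eq_1 mult.assoc)
  then have "(?B oo (fps_const ?c * fps_X)) * (?D oo (fps_const ?c * fps_X)) =
      fps_const ?c * fps_X"
    by (simp flip: fps_compose_mult_distrib)
  moreover have "?B oo (fps_const ?c * fps_X) = fps_const ?c * ab_fps c \<mu>"
    using assms(1)
    by (simp add: fps_eq_iff fps_nth_compose_linear ab_fps_def apostol_bernoulli_def power_int_diff)
  moreover have "?D oo (fps_const ?c * fps_X) = fps_const \<mu> * fps_exp ?c - 1"
    by (simp add: fps_compose_sub_distrib fps_compose_mult_distrib fps_exp_compose_linear
        flip: fps_const_mult_apply_left)
  ultimately have "fps_const ?c * (ab_fps c \<mu> * (fps_const \<mu> * fps_exp ?c - 1)) =
      fps_const ?c * fps_X"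
    by (simp add: mult.assoc)
  then show ?thesis
    using assms(1) by simp
qed

text \<open>These are the terms of the Cauchy product; \<open>1 / (i! (n - i)!)\<close> supplies the
  binomial coefficient over \<open>n!\<close>.\<close>

lemma ab_fps_nth_mult:
  assumes "i \<le> n"
  shows "ab_fps a \<mu> $ i * ab_fps b \<nu> $ (n - i) =
    of_nat (n choose i) * of_nat a powi (int i - 1) * of_nat b powi (int n - int i - 1) *
      apostol_bernoulli i \<mu> * apostol_bernoulli (n - i) \<nu> / fact n"
  using assms by (simp add: ab_fps_def binomial_fact of_nat_diff)

lemma apostol_bernoulli_0:
  assumes "\<mu> \<noteq> 1"
  shows "apostol_bernoulli 0 \<mu> = 0"
  using assms by (simp add: apostol_bernoulli_def fps_divide_unit)

lemma power_mult_power_int: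
  fixes x :: "'a::field"
  assumes "x \<noteq> 0"
  shows "x ^ n * x powi k = x powi (int n + k)"
  using assms by (simp add: power_int_add)

text \<open>The coefficient of \<open>X^m\<close> in \<open>lam^n e^(n X)\<close> is
  \<open>lam^n n^m / m!\<close>; the factor \<open>lam\<close> makes up for the exponent
  \<open>n - 1\<close> in \<open>power_sum_NR\<close>.\<close>

lemma power_sum_NR_eq_fps_nth:
  assumes "lam \<noteq> 0"
  shows "(\<Sum>n\<in>NR a b. (fps_const lam * fps_exp 1) ^ n) $ m = lam * power_sum_NR lam m a b / fact m"
  using assms
  by (simp add: fps_sum_nth power_sum_NR_def sum_distrib_left sum_divide_distrib power_mult_distrib
      fps_exp_power_mult power_int_diff fps_const_power)

section \<open>Comparison of the coefficients of \<open>X^(m + 2)\<close>\<close>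

theorem theorem2:
  fixes a b m :: nat and lam :: complex
  assumes "a > 0" and "b > 0" and "gcd a b = 1"
    and "lam \<noteq> 0" and "lam ^ a \<noteq> 1" and "lam ^ b \<noteq> 1"
  shows "power_sum_NR lam m a b =
      lam powi (int a * int b - 1) *
        (\<Sum>l = 0..m. \<Sum>i = 0..l + 2.
           of_nat ((l + 2) choose i) * of_nat (m choose l) *
           (of_nat a powi (int m - int l + int i - 1) * of_nat b powi (int m - int i + 1) /
             (of_nat (l + 1) * of_nat (l + 2))) *
           apostol_bernoulli i (lam ^ a) * apostol_bernoulli (l + 2 - i) (lam ^ b))
      - 1 / (of_nat (m + 1) * of_nat (m + 2) * lam) *
        (\<Sum>i = 0..m + 2.
           of_nat ((m + 2) choose i) *
           of_nat a powi (int i - 1) * of_nat b powi (int m - int i + 1) *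
           apostol_bernoulli i (lam ^ a) * apostol_bernoulli (m + 2 - i) (lam ^ b))
      - apostol_bernoulli (m + 1) lam / (of_nat (m + 1) * lam)"
proof -
  define w where "w = fps_const lam * fps_exp 1"
  define S where "S = (\<Sum>n\<in>NR a b. w ^ n)"
  define A where "A = ab_fps a (lam ^ a)"
  define B where "B = ab_fps b (lam ^ b)"
  define C where "C = ab_fps 1 lam"
  have cop: "coprime a b"
    using assms(3) by (simp add: coprime_iff_gcd_eq_1)
  have w_power: "w ^ n = fps_const (lam ^ n) * fps_exp (of_nat n)" for n
    by (simp add: w_def power_mult_distrib fps_exp_power_mult fps_const_power)
  have "lam \<noteq> 1"
    using assms(5) by auto
  have AX: "A * (w ^ a - 1) = fps_X" and BX: "B * (w ^ b - 1) = fps_X" and CX: "C * (w - 1) = fps_X"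
    using ab_fps_mult[of a "lam ^ a"] ab_fps_mult[of b "lam ^ b"] ab_fps_mult[of 1 lam] assms
      \<open>lam \<noteq> 1\<close>
    by (simp_all add: A_def B_def C_def w_power) (simp_all add: w_def)
  \<comment> \<open>Each of \<open>A\<close>, \<open>B\<close>, \<open>C\<close> trades one
    \<open>fps_X\<close> for a factor needed in \<open>sum_NR_power\<close>; one
    \<open>fps_X\<close> cancels at the end.\<close>
  have "fps_X * (S * fps_X ^ 2) =
      S * (C * (w - 1)) * (A * (w ^ a - 1)) * (B * (w ^ b - 1))"
    by (simp add: AX BX CX power2_eq_square mult_ac)
  also have "\<dots> = (S * (w - 1) * (w ^ a - 1) * (w ^ b - 1)) * (A * B * C)"
    by (simp only: mult_ac)
  also have "\<dots> = (w ^ (a * b) - 1) * A * B * (C * (w - 1)) -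
      C * (A * (w ^ a - 1)) * (B * (w ^ b - 1))"
    unfolding S_def sum_NR_power[OF assms(2) cop] by (simp add: algebra_simps)
  also have "\<dots> = fps_X * ((w ^ (a * b) - 1) * A * B - fps_X * C)"
    unfolding AX BX CX by (simp add: algebra_simps)
  finally have "S * fps_X ^ 2 = (w ^ (a * b) - 1) * A * B - fps_X * C"
    by (simp only: mult_cancel_left fps_X_neq_zero simp_thms)
  then have SX: "S * fps_X ^ 2 = w ^ (a * b) * (A * B) - A * B - fps_X * C"
    by (simp add: algebra_simps)
  define E where "E = fps_exp (of_nat (a * b) :: complex)"
  have AB: "(A * B) $ n = (\<Sum>i = 0..n. of_nat (n choose i) * of_nat a powi (int i - 1) *
      of_nat b powi (int n - int i - 1) * apostol_bernoulli i (lam ^ a) *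
      apostol_bernoulli (n - i) (lam ^ b)) / fact n" for n
    by (simp add: fps_mult_nth A_def B_def ab_fps_nth_mult sum_divide_distrib)
  \<comment> \<open>Both series lack a constant term, so \<open>A * B\<close> starts at
    \<open>X^2\<close>. This allows the shift to \<open>l = n - 2\<close> with \<open>l\<close> from
    0 to \<open>m\<close>.\<close>
  have "A $ 0 = 0" "B $ 0 = 0"
    using assms by (simp_all add: A_def B_def ab_fps_def apostol_bernoulli_0)
  then have AB01: "(A * B) $ 0 = 0" "(A * B) $ Suc 0 = 0"
    by (simp_all add: fps_mult_nth)
  have "(A * B * E) $ (m + 2) = (\<Sum>n = 0..m + 2. (A * B) $ n * E $ (m + 2 - n))"
    by (rule fps_mult_nth)
  also have "\<dots> = (\<Sum>l = 0..m. (A * B) $ (l + 2) * E $ (m - l))"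
    unfolding add_2_eq_Suc' sum.atLeast0_atMost_Suc_shift o_def AB01 by simp
  finally have ABE: "(A * B * E) $ (m + 2) = (\<Sum>l = 0..m. (A * B) $ (l + 2) * E $ (m - l))" .
  have "lam * power_sum_NR lam m a b / fact m = (S * fps_X ^ 2) $ (m + 2)"
    using power_sum_NR_eq_fps_nth[OF assms(4), of a b m]
    by (simp add: S_def w_def fps_X_power_mult_right_nth)
  also have "\<dots> = lam ^ (a * b) * (A * B * E) $ (m + 2) - (A * B) $ (m + 2) - C $ (m + 1)"
    unfolding SX w_power E_def by (simp add: mult.assoc mult.commute[of "fps_exp _"])
  finally have "power_sum_NR lam m a b = (lam ^ (a * b) * (fact m * (A * B * E) $ (m + 2))
      - fact m * (A * B) $ (m + 2) - fact m * C $ (m + 1)) / lam"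
    using assms(4) by (simp add: field_simps)
  then have main: "power_sum_NR lam m a b = lam ^ (a * b) / lam * (fact m * (A * B * E) $ (m + 2))
      - fact m * (A * B) $ (m + 2) / lam - fact m * C $ (m + 1) / lam"
    by (simp add: diff_divide_distrib)
  have fact2: "fact (n + 2) = (of_nat (n + 1) * of_nat (n + 2) * fact n :: complex)" for n
    by (simp add: algebra_simps)
  have T1: "fact m * (A * B * E) $ (m + 2) = (\<Sum>l = 0..m. \<Sum>i = 0..l + 2.
           of_nat ((l + 2) choose i) * of_nat (m choose l) *
           (of_nat a powi (int m - int l + int i - 1) * of_nat b powi (int m - int i + 1) /
             (of_nat (l + 1) * of_nat (l + 2))) *
           apostol_bernoulli i (lam ^ a) * apostol_bernoulli (l + 2 - i) (lam ^ b))"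
    unfolding ABE sum_distrib_left
  proof (rule sum.cong[OF refl])
    fix l assume "l \<in> {0..m}"
    then have l: "l \<le> m" by simp
    \<comment> \<open>The coefficient of \<open>E\<close> is
      \<open>(a b)^(m - l) / (m - l)!\<close>, and \<open>m! / ((l + 2)! (m - l)!)\<close> is the
      binomial coefficient over \<open>(l + 1) (l + 2)\<close>.\<close>
    have "fact m * ((A * B) $ (l + 2) * E $ (m - l)) =
      of_nat (m choose l) / (of_nat (l + 1) * of_nat (l + 2)) * of_nat (a * b) ^ (m - l) *
        (fact (l + 2) * (A * B) $ (l + 2))"
      using l unfolding E_def fact2 by (simp add: binomial_fact del: of_nat_add of_nat_Suc)
    also have "\<dots> = (\<Sum>i = 0..l + 2.
           of_nat ((l + 2) choose i) * of_nat (m choose l) *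
           (of_nat a powi (int m - int l + int i - 1) * of_nat b powi (int m - int i + 1) /
             (of_nat (l + 1) * of_nat (l + 2))) *
           apostol_bernoulli i (lam ^ a) * apostol_bernoulli (l + 2 - i) (lam ^ b))"
      unfolding AB sum_distrib_left sum_divide_distrib
    proof (rule sum.cong[OF refl])
      fix i
      \<comment> \<open>The power \<open>(a b)^(m - l)\<close> is shared out between the powers of
        \<open>a\<close> and \<open>b\<close>. Their exponents can be -1, at \<open>l = m\<close>
        with \<open>i = 0\<close> and \<open>i = m + 2\<close> respectively, hence the integer
        powers.\<close>
      have pa: "of_nat a powi (int m - int l + int i - 1) =
          (of_nat a ^ (m - l) * of_nat a powi (int i - 1) :: complex)"
        using assms(1) l by (simp add: power_mult_power_int of_nat_diff algebra_simps)
      have pb: "of_nat b powi (int m - int i + 1) =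
          (of_nat b ^ (m - l) * of_nat b powi (int (l + 2) - int i - 1) :: complex)"
        using assms(2) l by (simp add: power_mult_power_int of_nat_diff algebra_simps)
      show "of_nat (m choose l) / (of_nat (l + 1) * of_nat (l + 2)) * of_nat (a * b) ^ (m - l) *
          (fact (l + 2) * (of_nat ((l + 2) choose i) * of_nat a powi (int i - 1) *
            of_nat b powi (int (l + 2) - int i - 1) * apostol_bernoulli i (lam ^ a) *
            apostol_bernoulli (l + 2 - i) (lam ^ b) / fact (l + 2))) =
         of_nat ((l + 2) choose i) * of_nat (m choose l) *
           (of_nat a powi (int m - int l + int i - 1) * of_nat b powi (int m - int i + 1) /
             (of_nat (l + 1) * of_nat (l + 2))) *
           apostol_bernoulli i (lam ^ a) * apostol_bernoulli (l + 2 - i) (lam ^ b)"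
        unfolding pa pb by (simp add: power_mult_distrib del: of_nat_add fact_Suc binomial_Suc_Suc)
    qed
    finally show "fact m * ((A * B) $ (l + 2) * E $ (m - l)) = \<dots>" .
  qed
  have exponent: "int (m + 2) - int i - 1 = int m - int i + 1" for i
    by simp
  have T2: "fact m * (A * B) $ (m + 2) / lam = 1 / (of_nat (m + 1) * of_nat (m + 2) * lam) *
        (\<Sum>i = 0..m + 2.
           of_nat ((m + 2) choose i) *
           of_nat a powi (int i - 1) * of_nat b powi (int m - int i + 1) *
           apostol_bernoulli i (lam ^ a) * apostol_bernoulli (m + 2 - i) (lam ^ b))"
    unfolding AB fact2 exponent by (simp del: of_nat_add of_nat_Suc)
  \<comment> \<open>With \<open>c = 1\<close> the scaling powers are 1, and
    \<open>m! / (m + 1)!\<close> leaves \<open>1 / (m + 1)\<close>.\<close>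
  have T3: "fact m * C $ (m + 1) / lam = apostol_bernoulli (m + 1) lam / (of_nat (m + 1) * lam)"
    by (simp add: C_def ab_fps_def)
  have "lam powi (int a * int b - 1) = lam ^ (a * b) / lam"
    using assms(4) by (simp add: power_int_diff flip: of_nat_mult)
  then show ?thesis
    unfolding main T1 T2 T3 by simp
qed

end
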